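(* Let $G$ be an infinite compact group. Then $G$ has a quotient group which is an infinite separable metrizable (compact) group.
   Context: All topological groups are assumed to be Hausdorff. A quotient group of a topological group $G$ means $G/N$ with the quotient topology, where $N$ is a closed normal subgroup of $G$ (the case $N=\{e\}$ is allowed). *)

theory Defs
  imports "HOL-Analysis.Analysis" "HOL-Algebra.Coset"
begin

text \<open>Topological groups are Hausdorff by convention.\<close>

locale topological_group = group G for G (structure) +
  fixes T :: "'a topology"
  assumes topspace_eq: "topspace T = carrier G"
    and continuous_mult: "continuous_map (prod_topology T T) T (\<lambda>(x, y). x \<otimes> y)"
    and continuous_inv: "continuous_map T T (\<lambda>x. inv x)"
    and hausdorff: "Hausdorff_space T"

text \<open>
  The topology on the set of right cosets (the carrier of \<^term>\<open>G Mod N\<close>) coinduced by the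
  canonical projection.
\<close>

definition quotient_topology ::
    "('a, 'm) monoid_scheme \<Rightarrow> 'a topology \<Rightarrow> 'a set \<Rightarrow> 'a set topology" where
  "quotient_topology G T N =
     topology (\<lambda>U. U \<subseteq> carrier (G Mod N) \<and> openin T {x \<in> carrier G. N #>\<^bsub>G\<^esub> x \<in> U})"

lemma (in topological_group) openin_quotient_topology:
  "openin (quotient_topology G T N) U \<longleftrightarrow>
     U \<subseteq> carrier (G Mod N) \<and> openin T {x \<in> carrier G. N #> x \<in> U}"
proof -
  have "istopology (\<lambda>U. U \<subseteq> carrier (G Mod N) \<and> openin T {x \<in> carrier G. N #> x \<in> U})"
    unfolding istopology_def
  proof (intro conjI allI impI)
    fix S U
    assume S: "S \<subseteq> carrier (G Mod N) \<and> openin T {x \<in> carrier G. N #> x \<in> S}"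
      and U: "U \<subseteq> carrier (G Mod N) \<and> openin T {x \<in> carrier G. N #> x \<in> U}"
    then show "S \<inter> U \<subseteq> carrier (G Mod N)" by blast
    have "{x \<in> carrier G. N #> x \<in> S \<inter> U}
        = {x \<in> carrier G. N #> x \<in> S} \<inter> {x \<in> carrier G. N #> x \<in> U}" by blast
    with S U show "openin T {x \<in> carrier G. N #> x \<in> S \<inter> U}" by (simp add: openin_Int)
  next
    fix \<K>
    assume K: "\<forall>K\<in>\<K>. K \<subseteq> carrier (G Mod N) \<and> openin T {x \<in> carrier G. N #> x \<in> K}"
    then show "\<Union>\<K> \<subseteq> carrier (G Mod N)" by blast
    have "{x \<in> carrier G. N #> x \<in> \<Union>\<K>} = (\<Union>K\<in>\<K>. {x \<in> carrier G. N #> x \<in> K})" by blast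
    with K show "openin T {x \<in> carrier G. N #> x \<in> \<Union>\<K>}" by auto
  qed
  then show ?thesis
    by (simp add: quotient_topology_def topology_inverse')
qed

lemma (in topological_group) topspace_quotient_topology:
  "topspace (quotient_topology G T N) = carrier (G Mod N)"
proof (rule antisym)
  show "topspace (quotient_topology G T N) \<subseteq> carrier (G Mod N)"
    using openin_quotient_topology openin_topspace by blast
  have "{x \<in> carrier G. N #> x \<in> carrier (G Mod N)} = topspace T"
    by (auto simp: carrier_FactGroup topspace_eq)
  then have "openin (quotient_topology G T N) (carrier (G Mod N))"
    by (simp add: openin_quotient_topology)
  then show "carrier (G Mod N) \<subseteq> topspace (quotient_topology G T N)"
    by (rule openin_subset)
qed

lemma (in topological_group) quotient_map_quotient_topology:
  "quotient_map T (quotient_topology G T N) (\<lambda>x. N #> x)"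
  unfolding quotient_map_def topspace_quotient_topology
  by (auto simp: openin_quotient_topology topspace_eq carrier_FactGroup)

end

theory Submission
  imports Defs
begin

text \<open>
  Urysohn functions separating the pairs of an injective sequence combine into a continuous map
  \<open>f\<close> from \<open>G\<close> to a countable power of the reals with infinite image. The elements \<open>x\<close> with
  \<open>f (a x b) = f (a b)\<close> for all \<open>a\<close> and \<open>b\<close> form a normal subgroup \<open>N\<close>, and \<open>f\<close> is constant on
  its cosets, so \<open>G / N\<close> is infinite. Sending \<open>x\<close> to the function \<open>(a, b) \<mapsto> f (a x b)\<close> embeds
  \<open>G / N\<close> into the bounded functions on \<open>G \<times> G\<close> with the supremum metric; compactness gives
  continuity (tube lemma) and makes the continuous injection an embedding.
\<close>

section \<open>Compact Hausdorff and compact metrizable spaces\<close>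

text \<open>Complete regularity supplies a real function for each pair of terms of an injective
  sequence. The index type \<open>nat \<times> nat\<close> is countable, so the power of the reals
  is an instance of \<open>metric_space\<close>, as the later lemmas require of the
  codomain.\<close>

lemma ex_continuous_map_infinite_image:
  assumes "compact_space X" "Hausdorff_space X" "infinite (topspace X)"
  obtains f :: "'a \<Rightarrow> nat \<times> nat \<Rightarrow> real"
  where "continuous_map X euclidean f" "infinite (f ` topspace X)"
proof -
  obtain s :: "nat \<Rightarrow> 'a" where s: "inj s" "range s \<subseteq> topspace X"
    using assms(3)[unfolded infinite_iff_countable_subset] by blast
  have creg: "completely_regular_space X"
    using assms(1,2) compact_Hausdorff_or_regular_imp_normal_space
      normal_imp_completely_regular_space by blast
  have "\<exists>g. continuous_map X euclideanreal g \<and> (i \<noteq> j \<longrightarrow> g (s i) \<noteq> g (s j))" for i j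
  proof (cases "i = j")
    case True
    then show ?thesis
      \<comment> \<open>Diagonal pairs impose no separation; any continuous function serves, so that
        \<open>g\<close> can be chosen for all pairs.\<close>
      by (intro exI[of _ "\<lambda>_. 0"]) auto
  next
    case False
    have "closedin X {s j}"
      using s(2) by (intro closedin_Hausdorff_singleton assms(2)) auto
    moreover have "s i \<in> topspace X - {s j}"
      using s(2) inj_eq[OF s(1)] False by auto
    ultimately obtain g where "continuous_map X euclideanreal g" "g (s i) = 0" "g ` {s j} \<subseteq> {1}"
      using creg unfolding completely_regular_space_alt by blast
    then show ?thesis
      by (intro exI[of _ g]) auto
  qed
  then obtain g where g: "\<And>i j. continuous_map X euclideanreal (g i j)"
      "\<And>i j. i \<noteq> j \<Longrightarrow> g i j (s i) \<noteq> g i j (s j)"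
    by metis
  define f where "f x = (\<lambda>(i, j). g i j x)" for x
  show thesis
  proof
    show "continuous_map X euclidean f"
      unfolding euclidean_product_topology[symmetric] continuous_map_componentwise_UNIV
      by (auto simp: f_def g(1))
    have "inj (f \<circ> s)"
    proof (rule injI, rule ccontr)
      fix i j assume eq: "(f \<circ> s) i = (f \<circ> s) j" and "i \<noteq> j"
      have "g i j (s i) = g i j (s j)"
        using fun_cong[OF eq, of "(i, j)"] by (simp add: f_def)
      with g(2) \<open>i \<noteq> j\<close> show False by blast
    qed
    then have "infinite (f ` range s)"
      by (metis finite_imageD image_comp infinite_UNIV_nat)
    then show "infinite (f ` topspace X)"
      using s(2) finite_subset image_mono by metis
  qed
qed

text \<open>Compactness gives total boundedness; the union of finite nets of radius 1/(n+1) over all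
  n is countable and dense.\<close>

lemma compact_metrizable_imp_separable_space:
  assumes "compact_space X" "metrizable_space X"
  shows "separable_space X"
proof -
  obtain M d where M: "Metric_space M d" and X: "X = Metric_space.mtopology M d"
    using assms(2) by (auto simp: metrizable_space_def)
  interpret Metric_space M d by (rule M)
  have "mtotally_bounded M"
    using assms(1) compactin_imp_mtotally_bounded by (simp add: X compact_space_def)
  then have "\<exists>K. finite K \<and> K \<subseteq> M \<and> M \<subseteq> (\<Union>x\<in>K. mball x (inverse (real (Suc n))))" for n
    unfolding mtotally_bounded_def by (meson inverse_positive_iff_positive of_nat_0_less_iff zero_less_Suc)
  then obtain K where K: "\<And>n. finite (K n)" "\<And>n. K n \<subseteq> M"
      "\<And>n. M \<subseteq> (\<Union>x\<in>K n. mball x (inverse (real (Suc n))))"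
    by metis
  have "M \<subseteq> mtopology closure_of (\<Union>n. K n)"
  proof
    fix x assume x: "x \<in> M"
    have "\<exists>y\<in>\<Union>n. K n. y \<in> mball x r" if "r > 0" for r
    proof -
      obtain n where n: "inverse (real (Suc n)) < r"
        using \<open>r > 0\<close> reals_Archimedean by blast
      obtain y where "y \<in> K n" "x \<in> mball y (inverse (real (Suc n)))"
        using K(3) x by blast
      then show ?thesis
        using n by (intro bexI[of _ y]) (auto simp: commute)
    qed
    with x show "x \<in> mtopology closure_of (\<Union>n. K n)"
      by (simp add: metric_closure_of)
  qed
  then show ?thesis
    unfolding separable_space_def X
    using K(1,2) closure_of_subset_topspace[of mtopology "\<Union>n. K n"]
    by (intro exI[of _ "\<Union>n. K n"]) (auto intro: countable_finite)
qed

section \<open>Quotients of a compact group\<close>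

context topological_group
begin

lemma continuous_map_mult:
  assumes "continuous_map X T f" "continuous_map X T g"
  shows "continuous_map X T (\<lambda>x. f x \<otimes> g x)"
  using continuous_map_compose[OF continuous_map_pairedI[OF assms] continuous_mult]
  by (simp add: o_def)

lemma compact_space_quotient_topology:
  assumes "compact_space T"
  shows "compact_space (quotient_topology G T N)"
  using assms image_compactin quotient_map_quotient_topology
    quotient_imp_continuous_map quotient_imp_surjective_map
  unfolding compact_space_def by metis

text \<open>The coset \<open>N\<close> is a point of the quotient, hence closed there, and its
  preimage under the projection is \<open>N\<close> itself.\<close>

lemma closedin_of_Hausdorff_quotient:
  assumes "N \<lhd> G" "Hausdorff_space (quotient_topology G T N)"
  shows "closedin T N"
proof -
  interpret normal N G by (rule assms)
  have "N \<in> carrier (G Mod N)"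
    using coset_mult_one[OF subset] one_closed by (force simp: carrier_FactGroup)
  then have "closedin (quotient_topology G T N) {N}"
    by (simp add: closedin_Hausdorff_singleton assms(2) topspace_quotient_topology)
  then have "closedin T {x \<in> topspace T. N #> x \<in> {N}}"
    by (rule closedin_continuous_map_preimage
        [OF quotient_imp_continuous_map[OF quotient_map_quotient_topology]])
  moreover have "{x \<in> topspace T. N #> x \<in> {N}} = N"
    using rcos_const subset coset_join1 topspace_eq is_subgroup by auto
  ultimately show ?thesis by simp
qed

text \<open>Both operations descend along quotient maps: inversion along the projection,
  multiplication along the square of the projection.\<close>

lemma topological_group_FactGroup:
  assumes N: "N \<lhd> G" and "compact_space T" "Hausdorff_space (quotient_topology G T N)"
  shows "topological_group (G Mod N) (quotient_topology G T N)"
proof -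
  let ?Q = "quotient_topology G T N" and ?q = "\<lambda>x. N #> x"
  interpret normal N G by (rule N)
  interpret Q: group "G Mod N" by (rule factorgroup_is_group)
  have q: "continuous_map T ?Q ?q"
    using quotient_map_quotient_topology quotient_imp_continuous_map by blast
  have surj: "?q ` topspace T = topspace ?Q"
    using quotient_map_quotient_topology quotient_imp_surjective_map by blast
  show ?thesis
  proof
    show "topspace ?Q = carrier (G Mod N)"
      by (rule topspace_quotient_topology)
    show "Hausdorff_space ?Q"
      by (rule assms)
    show "continuous_map ?Q ?Q (\<lambda>x. inv\<^bsub>G Mod N\<^esub> x)"
    proof (subst continuous_compose_quotient_map_eq[OF quotient_map_quotient_topology, symmetric])
      have "continuous_map T ?Q (\<lambda>x. N #> inv x)"
        using continuous_map_compose[OF continuous_inv q] by (simp add: o_def)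
      then show "continuous_map T ?Q ((\<lambda>x. inv\<^bsub>G Mod N\<^esub> x) \<circ> ?q)"
        by (rule continuous_map_eq)
          (auto simp: topspace_eq inv_FactGroup carrier_FactGroup rcos_inv)
    qed
    let ?qq = "\<lambda>(x, y). (N #> x, N #> y)"
    \<comment> \<open>A product of quotient maps is not a quotient map in general. Here a continuous
      surjection goes from a compact space onto a Hausdorff space, which suffices.\<close>
    have "quotient_map (prod_topology T T) (prod_topology ?Q ?Q) ?qq"
    proof (rule continuous_imp_quotient_map)
      show "continuous_map (prod_topology T T) (prod_topology ?Q ?Q) ?qq"
        using q by (simp add: continuous_map_prod_top)
      show "compact_space (prod_topology T T)" "Hausdorff_space (prod_topology ?Q ?Q)"
        using assms by (auto simp: compact_space_prod_topology Hausdorff_space_prod_topology)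
      show "?qq ` topspace (prod_topology T T) = topspace (prod_topology ?Q ?Q)"
        by (simp add: surj[symmetric] image_paired_Times)
    qed
    then show "continuous_map (prod_topology ?Q ?Q) ?Q (\<lambda>(x, y). x \<otimes>\<^bsub>G Mod N\<^esub> y)"
    proof (subst continuous_compose_quotient_map_eq[symmetric], assumption)
      have "continuous_map (prod_topology T T) ?Q (\<lambda>(x, y). N #> (x \<otimes> y))"
        using continuous_map_compose[OF continuous_mult q] by (simp add: o_def case_prod_unfold)
      then show "continuous_map (prod_topology T T) ?Q ((\<lambda>(x, y). x \<otimes>\<^bsub>G Mod N\<^esub> y) \<circ> ?qq)"
        by (rule continuous_map_eq) (auto simp: topspace_eq rcos_sum)
    qed
  qed
qed

section \<open>The normal subgroup of periods of a function\<close>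

text \<open>The largest normal subgroup on whose cosets the function is constant.\<close>

definition normal_period :: "('a \<Rightarrow> 'c) \<Rightarrow> 'a set" where
  "normal_period f =
     {x \<in> carrier G. \<forall>a\<in>carrier G. \<forall>b\<in>carrier G. f (a \<otimes> x \<otimes> b) = f (a \<otimes> b)}"

lemma normal_periodI:
  assumes "x \<in> carrier G"
    and "\<And>a b. a \<in> carrier G \<Longrightarrow> b \<in> carrier G \<Longrightarrow> f (a \<otimes> x \<otimes> b) = f (a \<otimes> b)"
  shows "x \<in> normal_period f"
  using assms unfolding normal_period_def by blast

lemma normal_periodD:
  assumes "x \<in> normal_period f" "a \<in> carrier G" "b \<in> carrier G"
  shows "f (a \<otimes> x \<otimes> b) = f (a \<otimes> b)"
  using assms unfolding normal_period_def by blast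

lemma normal_period_closed: "x \<in> normal_period f \<Longrightarrow> x \<in> carrier G"
  unfolding normal_period_def by blast

text \<open>The two free factors \<open>a\<close> and \<open>b\<close> absorb whatever surrounds
  \<open>x\<close>: for products \<open>y\<close> moves into \<open>b\<close>, and for a conjugate
  \<open>g\<close> moves into \<open>a\<close> and \<open>inv g\<close> into
  \<open>b\<close>.\<close>

lemma normal_normal_period: "normal_period f \<lhd> G"
  unfolding normal_inv_iff
proof (intro conjI ballI)
  show "subgroup (normal_period f) G"
  proof
    show "normal_period f \<subseteq> carrier G" "\<one> \<in> normal_period f"
      by (auto intro: normal_periodI normal_period_closed)
  next
    fix x y assume x: "x \<in> normal_period f" and y: "y \<in> normal_period f"
    note [simp] = x[THEN normal_period_closed] y[THEN normal_period_closed]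
    show "x \<otimes> y \<in> normal_period f"
    proof (rule normal_periodI)
      fix a b assume [simp]: "a \<in> carrier G" "b \<in> carrier G"
      show "f (a \<otimes> (x \<otimes> y) \<otimes> b) = f (a \<otimes> b)"
        using normal_periodD[OF x, of a "y \<otimes> b"] normal_periodD[OF y, of a b]
        by (simp add: m_assoc)
    qed simp
  next
    fix x assume x: "x \<in> normal_period f"
    note [simp] = x[THEN normal_period_closed]
    show "inv x \<in> normal_period f"
    proof (rule normal_periodI)
      fix a b assume [simp]: "a \<in> carrier G" "b \<in> carrier G"
      show "f (a \<otimes> inv x \<otimes> b) = f (a \<otimes> b)"
        \<comment> \<open>With \<open>a \<otimes> inv x\<close> in place of \<open>a\<close>, the
          inserted \<open>x\<close> cancels.\<close>
        using normal_periodD[OF x, of "a \<otimes> inv x" b] by (simp add: m_assoc)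
    qed simp
  qed
next
  fix g x assume [simp]: "g \<in> carrier G" and x: "x \<in> normal_period f"
  note [simp] = x[THEN normal_period_closed]
  have cancel: "g \<otimes> (inv g \<otimes> b) = b" if "b \<in> carrier G" for b
    using that by (simp flip: m_assoc)
  show "g \<otimes> x \<otimes> inv g \<in> normal_period f"
  proof (rule normal_periodI)
    fix a b assume [simp]: "a \<in> carrier G" "b \<in> carrier G"
    show "f (a \<otimes> (g \<otimes> x \<otimes> inv g) \<otimes> b) = f (a \<otimes> b)"
      using normal_periodD[OF x, of "a \<otimes> g" "inv g \<otimes> b"] by (simp add: m_assoc cancel)
  qed simp
qed

lemma normal_period_rcoset:
  assumes "x \<in> carrier G" "y \<in> normal_period f #> x"
  shows "f y = f x"
proof -
  obtain n where n: "n \<in> normal_period f" "y = n \<otimes> x"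
    using assms(2) by (auto simp: r_coset_def)
  then show ?thesis
    using normal_periodD[OF n(1), of \<one> x] assms(1) normal_period_closed[OF n(1)] by simp
qed

text \<open>Since \<open>f\<close> is constant on cosets, it factors through the set of cosets, so
  finitely many cosets would allow only finitely many values.\<close>

lemma infinite_carrier_FactGroup_normal_period:
  assumes "infinite (f ` carrier G)"
  shows "infinite (carrier (G Mod normal_period f))"
proof
  let ?N = "normal_period f"
  interpret N: normal ?N G by (rule normal_normal_period)
  assume "finite (carrier (G Mod ?N))"
  \<comment> \<open>The coset contains \<open>x\<close>, so the choice is proper, and the value of
    \<open>f\<close> does not depend on the representative chosen.\<close>
  moreover have "f x = f (SOME y. y \<in> ?N #> x)" if x: "x \<in> carrier G" for x
    using rcos_self[OF x N.is_subgroup] normal_period_rcoset[OF x] by (metis someI)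
  then have "f ` carrier G \<subseteq> (\<lambda>A. f (SOME x. x \<in> A)) ` carrier (G Mod ?N)"
    by (auto simp: carrier_FactGroup)
  ultimately show False
    using assms by (meson finite_imageI finite_subset)
qed

section \<open>Embedding the quotient into a function space\<close>

text \<open>The restriction makes the values extensional, as membership in \<open>funspace\<close>
  demands, and turns equality of functions into equality on the carrier.\<close>

definition two_sided_translates :: "('a \<Rightarrow> 'c) \<Rightarrow> 'a \<Rightarrow> 'a \<times> 'a \<Rightarrow> 'c" where
  "two_sided_translates f x = restrict (\<lambda>(a, b). f (a \<otimes> x \<otimes> b)) (carrier G \<times> carrier G)"

text \<open>The fibres of the translate map are exactly the cosets, so the map factors injectively
  through the quotient. Replacing \<open>b\<close> by \<open>inv y \<otimes> b\<close> turns
  equality of the translates into the period condition for \<open>x \<otimes> inv y\<close>;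
  replacing \<open>b\<close> by \<open>y \<otimes> b\<close> goes back.\<close>

lemma two_sided_translates_eq_iff:
  assumes x: "x \<in> carrier G" and y: "y \<in> carrier G"
  shows "two_sided_translates f x = two_sided_translates f y \<longleftrightarrow>
    normal_period f #> x = normal_period f #> y"
proof -
  interpret N: normal "normal_period f" G by (rule normal_normal_period)
  have "two_sided_translates f x = two_sided_translates f y \<longleftrightarrow>
      (\<forall>a\<in>carrier G. \<forall>b\<in>carrier G. f (a \<otimes> x \<otimes> b) = f (a \<otimes> y \<otimes> b))" (is "_ \<longleftrightarrow> ?L")
    by (auto simp: two_sided_translates_def restrict_def fun_eq_iff)
  also have "\<dots> \<longleftrightarrow> x \<otimes> inv y \<in> normal_period f"
  proof
    assume L: ?L
    show "x \<otimes> inv y \<in> normal_period f"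
    proof (rule normal_periodI)
      fix a b assume ab: "a \<in> carrier G" "b \<in> carrier G"
      have "f (a \<otimes> x \<otimes> (inv y \<otimes> b)) = f (a \<otimes> y \<otimes> (inv y \<otimes> b))"
        using L ab y by simp
      moreover have "y \<otimes> (inv y \<otimes> b) = b"
        using y ab by (simp flip: m_assoc)
      ultimately show "f (a \<otimes> (x \<otimes> inv y) \<otimes> b) = f (a \<otimes> b)"
        using x y ab by (simp add: m_assoc)
    qed (use x y in simp)
  next
    assume R: "x \<otimes> inv y \<in> normal_period f"
    show ?L
    proof (intro ballI)
      fix a b assume ab: "a \<in> carrier G" "b \<in> carrier G"
      have "f (a \<otimes> (x \<otimes> inv y) \<otimes> (y \<otimes> b)) = f (a \<otimes> (y \<otimes> b))"
        using normal_periodD[OF R] ab y by simp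
      moreover have "inv y \<otimes> (y \<otimes> b) = b"
        using y ab by (simp flip: m_assoc)
      ultimately show "f (a \<otimes> x \<otimes> b) = f (a \<otimes> y \<otimes> b)"
        using x y ab by (simp add: m_assoc)
    qed
  qed
  also have "\<dots> \<longleftrightarrow> normal_period f #> x = normal_period f #> y"
    using x y N.rcos_module N.is_subgroup repr_independence repr_independenceD
    by (metis is_group)
  finally show ?thesis .
qed

text \<open>Translates are bounded because \<open>f\<close> has compact image. Continuity for the
  supremum metric needs one neighbourhood of \<open>x\<close> that works for all
  \<open>(a, b)\<close> at once; the tube lemma over the compact set of pairs provides it.\<close>

lemma continuous_map_two_sided_translates:
  fixes f :: "'a \<Rightarrow> 'c::metric_space"
  assumes "compact_space T" and f: "continuous_map T euclidean f"
  defines "F \<equiv> funspace (carrier G \<times> carrier G) euclidean_metric"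
  shows "continuous_map T (mtopology_of F) (two_sided_translates f)"
proof -
  have mem: "two_sided_translates f x \<in> mspace F" if "x \<in> carrier G" for x
  proof -
    have "compactin euclidean (f ` topspace T)"
      using assms(1) f image_compactin unfolding compact_space_def by blast
    then have "bounded (f ` carrier G)"
      by (simp add: topspace_eq compact_imp_bounded)
    moreover have "two_sided_translates f x ` (carrier G \<times> carrier G) \<subseteq> f ` carrier G"
      using that by (auto simp: two_sided_translates_def)
    ultimately have "bounded (two_sided_translates f x ` (carrier G \<times> carrier G))"
      by (rule bounded_subset)
    then show ?thesis
      by (simp add: F_def Met_TC.fspace_def two_sided_translates_def)
  qed
  have ne: "carrier G \<times> carrier G \<noteq> {}"
    using one_closed by blast
  have key: "\<exists>U. openin T U \<and> x \<in> U \<and>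
      (\<forall>y\<in>U. y \<in> carrier G \<and> mdist F (two_sided_translates f x) (two_sided_translates f y) \<le> e)"
    if x: "x \<in> carrier G" and e: "e > 0" for x and e :: real
  proof -
    let ?X = "prod_topology T (prod_topology T T)"
    \<comment> \<open>A point \<open>p\<close> stands for \<open>(y, (a, b))\<close>, and
      \<open>?h p\<close> compares the translates of \<open>x\<close> and \<open>y\<close> at
      \<open>(a, b)\<close>. It vanishes on the slice \<open>y = x\<close>, so the open set
      \<open>W\<close> below contains that slice.\<close>
    let ?h = "\<lambda>p. dist (f (fst (snd p) \<otimes> x \<otimes> snd (snd p))) (f (fst (snd p) \<otimes> fst p \<otimes> snd (snd p)))"
    have 1: "continuous_map ?X T (\<lambda>p. fst (snd p))"
      using continuous_map_compose[OF continuous_map_snd continuous_map_fst] by (simp add: o_def)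
    have 2: "continuous_map ?X T (\<lambda>p. snd (snd p))"
      using continuous_map_compose[OF continuous_map_snd continuous_map_snd] by (simp add: o_def)
    have 3: "continuous_map ?X T fst"
      by (rule continuous_map_fst)
    have 4: "continuous_map ?X T (\<lambda>p. x)"
      using x by (simp add: topspace_eq)
    have f_comp: "continuous_map ?X euclidean (\<lambda>p. f (g p))" if "continuous_map ?X T g" for g
      using continuous_map_compose[OF that f] by (simp add: o_def)
    have "continuous_map ?X euclideanreal ?h"
      unfolding mdist_euclidean_metric[symmetric]
      by (intro continuous_map_mdist)
        (simp_all only: mtopology_of_euclidean f_comp continuous_map_mult 1 2 3 4)
    moreover define W where "W = {p \<in> topspace ?X. ?h p \<in> {..<e}}"
    ultimately have W: "openin ?X W"
      using openin_continuous_map_preimage[of ?X euclideanreal ?h "{..<e}"]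
      by (simp flip: open_openin)
    have C: "compactin (prod_topology T T) (carrier G \<times> carrier G)"
      using assms(1) by (simp add: compactin_Times compact_space_def topspace_eq)
    have sub: "{x} \<times> (carrier G \<times> carrier G) \<subseteq> W" and "x \<in> topspace T"
      using x e by (auto simp: topspace_eq W_def)
    obtain U V where UV: "openin T U" "x \<in> U" "carrier G \<times> carrier G \<subseteq> V" "U \<times> V \<subseteq> W"
      using tube_lemma_right[OF W C \<open>x \<in> topspace T\<close> sub] by blast
    have U: "U \<subseteq> carrier G"
      using UV(1) openin_subset topspace_eq by blast
    have "mdist F (two_sided_translates f x) (two_sided_translates f y) \<le> e" if y: "y \<in> U" for y
    proof -
      have "dist (f (a \<otimes> x \<otimes> b)) (f (a \<otimes> y \<otimes> b)) \<le> e" if "a \<in> carrier G" "b \<in> carrier G" for a b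
      proof -
        have "(y, a, b) \<in> U \<times> V"
          using UV(3) y that by blast
        then show ?thesis
          using UV(4) by (force simp: W_def)
      qed
      then show ?thesis
        using mem U x y ne unfolding F_def
        by (subst funspace_mdist_le) (auto simp: two_sided_translates_def)
    qed
    then show ?thesis
      using UV(1,2) U by blast
  qed
  show ?thesis
    unfolding mtopology_of_def Metric_space.continuous_map_to_metric[OF Metric_space_mspace_mdist]
  proof (intro ballI allI impI)
    fix x and e :: real assume x: "x \<in> topspace T" and e: "0 < e"
    \<comment> \<open>\<open>key\<close> bounds the supremum only non-strictly; using it for
      \<open>e / 2\<close> lands inside the open ball of radius \<open>e\<close>.\<close>
    then have xG: "x \<in> carrier G" and "e / 2 > 0"
      by (simp_all add: topspace_eq)
    then obtain U where U: "openin T U" "x \<in> U"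
      "\<And>y. y \<in> U \<Longrightarrow> y \<in> carrier G \<and> mdist F (two_sided_translates f x) (two_sided_translates f y) \<le> e / 2"
      using key by meson
    have "two_sided_translates f y \<in> Metric_space.mball (mspace F) (mdist F) (two_sided_translates f x) e"
      if "y \<in> U" for y
      using U(3)[OF that] e mem xG
      by (simp add: Metric_space.in_mball[OF Metric_space_mspace_mdist])
    with U(1,2) show "\<exists>U. openin T U \<and> x \<in> U \<and>
        (\<forall>y\<in>U. two_sided_translates f y \<in> Metric_space.mball (mspace F) (mdist F) (two_sided_translates f x) e)"
      by blast
  qed
qed

text \<open>The translate map induces a continuous injection from the compact quotient into a metric
  space. Such an injection is an embedding, so the quotient inherits metrizability.\<close>

lemma metrizable_quotient_normal_period:
  fixes f :: "'a \<Rightarrow> 'c::metric_space"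
  assumes "compact_space T" and f: "continuous_map T euclidean f"
  shows "metrizable_space (quotient_topology G T (normal_period f))"
proof -
  let ?F = "mtopology_of (funspace (carrier G \<times> carrier G) (euclidean_metric :: 'c metric))"
  let ?N = "normal_period f"
  let ?Q = "quotient_topology G T ?N"
  note qm = quotient_map_quotient_topology[of ?N]
  have surj: "topspace ?Q = (\<lambda>x. ?N #> x) ` carrier G"
    using quotient_imp_surjective_map[OF qm] by (simp add: topspace_eq)
  have F: "metrizable_space ?F"
    unfolding mtopology_of_def
    by (rule Metric_space.metrizable_space_mtopology[OF Metric_space_mspace_mdist])
  \<comment> \<open>Elements of the same coset have equal translates, so the map descends; the
    converse implication makes \<open>h\<close> injective.\<close>
  obtain h where h: "continuous_map ?Q ?F h"
      "\<And>x. x \<in> carrier G \<Longrightarrow> h (?N #> x) = two_sided_translates f x"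
    using quotient_map_lift_exists[OF qm continuous_map_two_sided_translates[OF assms]]
    by (metis two_sided_translates_eq_iff topspace_eq)
  have "compact_space ?Q"
    using assms(1) by (rule compact_space_quotient_topology)
  moreover have "inj_on h (topspace ?Q)"
    unfolding surj by (auto simp: inj_on_def h(2) two_sided_translates_eq_iff)
  ultimately have "embedding_map ?Q ?F h"
    using continuous_imp_embedding_map h(1) metrizable_imp_Hausdorff_space[OF F] by blast
  then show ?thesis
    using F embedding_map_imp_homeomorphic_space homeomorphic_metrizable_space
      metrizable_space_subtopology by blast
qed

end

section \<open>An infinite metrizable quotient of an infinite compact group\<close>

theorem theorem2p6:
  fixes G :: "('a, 'm) monoid_scheme" and T :: "'a topology"
  assumes "topological_group G T"
    and "compact_space T"
    and "infinite (carrier G)"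
  shows "\<exists>N. N \<lhd> G \<and> closedin T N \<and>
           topological_group (G Mod N) (quotient_topology G T N) \<and>
           infinite (carrier (G Mod N)) \<and>
           compact_space (quotient_topology G T N) \<and>
           separable_space (quotient_topology G T N) \<and>
           metrizable_space (quotient_topology G T N)"
proof -
  interpret topological_group G T by (rule assms)
  obtain f :: "'a \<Rightarrow> nat \<times> nat \<Rightarrow> real"
    where f: "continuous_map T euclidean f" and inf: "infinite (f ` carrier G)"
    using ex_continuous_map_infinite_image[OF assms(2) hausdorff] assms(3) topspace_eq by metis
  let ?N = "normal_period f"
  have N: "?N \<lhd> G"
    by (rule normal_normal_period)
  \<comment> \<open>Metrizability comes first: it yields the Hausdorff property, from which both the
    closedness of \<open>?N\<close> and the topological group structure follow.\<close>
  have metr: "metrizable_space (quotient_topology G T ?N)"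
    using metrizable_quotient_normal_period assms(2) f .
  then have haus: "Hausdorff_space (quotient_topology G T ?N)"
    by (rule metrizable_imp_Hausdorff_space)
  have comp: "compact_space (quotient_topology G T ?N)"
    using assms(2) by (rule compact_space_quotient_topology)
  show ?thesis
  proof (intro exI conjI)
    show "?N \<lhd> G" "metrizable_space (quotient_topology G T ?N)"
      "compact_space (quotient_topology G T ?N)"
      by fact+
    show "closedin T ?N"
      using N haus by (rule closedin_of_Hausdorff_quotient)
    show "topological_group (G Mod ?N) (quotient_topology G T ?N)"
      using N assms(2) haus by (rule topological_group_FactGroup)
    show "infinite (carrier (G Mod ?N))"
      using inf by (rule infinite_carrier_FactGroup_normal_period)
    show "separable_space (quotient_topology G T ?N)"
      using comp metr by (rule compact_metrizable_imp_separable_space)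
  qed
qed

end
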